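(* Let $a,b\in\mathbb{R}$ with $b-a$ a positive integer, let $\alpha\in(0,1/2)$, and let $p,q,r$ be real-valued functions on $\mathbb{N}_{a,b}$ with $p(t)>0$ and $r(t)>0$ for all $t\in\mathbb{N}_{a,b}$. Then every eigenvalue $\lambda\in\mathbb{C}$ of the nabla discrete fractional Sturm--Liouville equation $${}^{ABR}_{a}\nabla^\alpha\big(p(t)\,{}^{ABR}\nabla^\alpha_b x(t)\big)+q(t)x(t)=\lambda r(t)x(t),\qquad t\in\mathbb{N}_{a+1,b-1},$$ is real.
   Context: Notation: $\mathbb{N}_{c,d}=\{c,c+1,\dots,d\}$ (empty if $d<c$); $\rho(t)=t-1$; $\nabla f(t)=f(t)-f(t-1)$, $\Delta f(t)=f(t+1)-f(t)$; empty sums are $0$. The rising function is $t^{\overline{\gamma}}=\Gamma(t+\gamma)/\Gamma(t)$. For $|\lambda|<1$ the nabla discrete Mittag-Leffler function is $E_{\overline{\alpha}}(\lambda,z)=\sum_{k=0}^\infty\lambda^k\frac{z^{\overline{k\alpha}}}{\Gamma(\alpha k+1)}$ (here used only for positive integers $z$). $B(\alpha)>0$ is a normalization constant. The left and right nabla discrete ABR fractional differences of order $\alpha\in(0,1/2)$ are $${}^{ABR}_{a}\nabla^\alpha f(t)=\frac{B(\alpha)}{1-\alpha}\nabla_t\sum_{s=a+1}^t f(s)E_{\overline{\alpha}}\Big(\tfrac{-\alpha}{1-\alpha},t-\rho(s)\Big),\quad t\in\{a+1,a+2,\dots\},$$ $${}^{ABR}\nabla_b^\alpha f(t)=-\frac{B(\alpha)}{1-\alpha}\Delta_t\sum_{s=t}^{b-1}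 f(s)E_{\overline{\alpha}}\Big(\tfrac{-\alpha}{1-\alpha},s-\rho(t)\Big),\quad t\in\{\dots,b-2,b-1\}.$$ An eigenvalue is a $\lambda\in\mathbb{C}$ for which the equation has a nontrivial solution $x:\mathbb{N}_{a,b}\to\mathbb{C}$, called an eigenfunction corresponding to $\lambda$; nontrivial means not identically zero on $\mathbb{N}_{a+1,b-1}$ (the equation involves only the values of $x$ on $\mathbb{N}_{a+1,b-1}$). *)

theory Defs
  imports "HOL-Analysis.Analysis"
begin

text \<open>Functions on a discrete time scale are total functions on the reals; only their values at the
  points of the relevant time scale matter. The set below is empty for \<open>d < c\<close>, so sums over it
  are then \<open>0\<close>.\<close>

definition time_scale :: "real \<Rightarrow> real \<Rightarrow> real set" where
  "time_scale c d = {c + real k | k. c + real k \<le> d}"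

definition rho :: "real \<Rightarrow> real" where
  "rho t = t - 1"

definition nabla :: "(real \<Rightarrow> complex) \<Rightarrow> real \<Rightarrow> complex" where
  "nabla f t = f t - f (t - 1)"

definition delta :: "(real \<Rightarrow> complex) \<Rightarrow> real \<Rightarrow> complex" where
  "delta f t = f (t + 1) - f t"

definition rising :: "real \<Rightarrow> real \<Rightarrow> real" where
  "rising t \<gamma> = Gamma (t + \<gamma>) / Gamma t"

text \<open>The series is meant for \<open>\<bar>l\<bar> < 1\<close> and positive integer \<open>z\<close>, where it converges.\<close>

definition nabla_ML :: "real \<Rightarrow> real \<Rightarrow> real \<Rightarrow> real" where
  "nabla_ML \<alpha> l z = (\<Sum>k. l ^ k * (rising z (real k * \<alpha>) / Gamma (\<alpha> * real k + 1)))"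

text \<open>\<open>B\<close> is the normalization function, \<open>\<alpha>\<close> the order. Both sums are taken for every real
  \<open>t\<close>; at \<open>t = a\<close> (reached by \<open>nabla\<close> at \<open>a + 1\<close>) and at \<open>t = b\<close> (reached by \<open>delta\<close> at
  \<open>b - 1\<close>) they are empty.\<close>

definition ABR_left :: "(real \<Rightarrow> real) \<Rightarrow> real \<Rightarrow> real \<Rightarrow> (real \<Rightarrow> complex) \<Rightarrow> real \<Rightarrow> complex" where
  "ABR_left B \<alpha> a f t =
     complex_of_real (B \<alpha> / (1 - \<alpha>)) *
     nabla (\<lambda>u. \<Sum>s\<in>time_scale (a + 1) u.
        f s * complex_of_real (nabla_ML \<alpha> (- \<alpha> / (1 - \<alpha>)) (u - rho s))) t"

definition ABR_right :: "(real \<Rightarrow> real) \<Rightarrow> real \<Rightarrow> real \<Rightarrow> (real \<Rightarrow> complex) \<Rightarrow> real \<Rightarrow> complex" where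
  "ABR_right B \<alpha> b f t =
     - complex_of_real (B \<alpha> / (1 - \<alpha>)) *
     delta (\<lambda>u. \<Sum>s\<in>time_scale u (b - 1).
        f s * complex_of_real (nabla_ML \<alpha> (- \<alpha> / (1 - \<alpha>)) (s - rho u))) t"

definition SL_solution ::
  "(real \<Rightarrow> real) \<Rightarrow> real \<Rightarrow> real \<Rightarrow> real \<Rightarrow> (real \<Rightarrow> real) \<Rightarrow> (real \<Rightarrow> real) \<Rightarrow> (real \<Rightarrow> real) \<Rightarrow>
   complex \<Rightarrow> (real \<Rightarrow> complex) \<Rightarrow> bool" where
  "SL_solution B \<alpha> a b p q r \<mu> x \<longleftrightarrow>
     (\<forall>t\<in>time_scale (a + 1) (b - 1).
        ABR_left B \<alpha> a (\<lambda>s. complex_of_real (p s) * ABR_right B \<alpha> b x s) t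
          + complex_of_real (q t) * x t
        = \<mu> * complex_of_real (r t) * x t)"

definition SL_eigenfunction ::
  "(real \<Rightarrow> real) \<Rightarrow> real \<Rightarrow> real \<Rightarrow> real \<Rightarrow> (real \<Rightarrow> real) \<Rightarrow> (real \<Rightarrow> real) \<Rightarrow> (real \<Rightarrow> real) \<Rightarrow>
   complex \<Rightarrow> (real \<Rightarrow> complex) \<Rightarrow> bool" where
  "SL_eigenfunction B \<alpha> a b p q r \<mu> x \<longleftrightarrow>
     SL_solution B \<alpha> a b p q r \<mu> x \<and> (\<exists>t\<in>time_scale (a + 1) (b - 1). x t \<noteq> 0)"

definition SL_eigenvalue ::
  "(real \<Rightarrow> real) \<Rightarrow> real \<Rightarrow> real \<Rightarrow> real \<Rightarrow> (real \<Rightarrow> real) \<Rightarrow> (real \<Rightarrow> real) \<Rightarrow> (real \<Rightarrow> real) \<Rightarrow>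
   complex \<Rightarrow> bool" where
  "SL_eigenvalue B \<alpha> a b p q r \<mu> \<longleftrightarrow> (\<exists>x. SL_eigenfunction B \<alpha> a b p q r \<mu> x)"

end

theory Submission
  imports Defs
begin

text \<open>On functions on \<open>time_scale (a + 1) (b - 1)\<close> the left ABR difference is a real matrix \<open>K\<close> and
  the right one is its transpose (discrete integration by parts); the values of the Mittag-Leffler
  function play no role beyond being real. Pairing the equation with the conjugate of an
  eigenfunction \<open>x\<close> therefore gives
  \<open>(\<Sum>t. p t * \<bar>(K\<^sup>T x) t\<bar>\<^sup>2) + (\<Sum>t. q t * \<bar>x t\<bar>\<^sup>2) = \<mu> * (\<Sum>t. r t * \<bar>x t\<bar>\<^sup>2)\<close>,
  where both sums on the left are real and the one on the right is positive.\<close>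

lemma weighted_gram_eigenvalue_real:
  fixes k :: "'a \<Rightarrow> 'a \<Rightarrow> real" and p q r :: "'a \<Rightarrow> real" and x :: "'a \<Rightarrow> complex"
  assumes fin: "finite T"
    and eq: "\<And>t. t \<in> T \<Longrightarrow>
      (\<Sum>s\<in>T. of_real (p s) * (\<Sum>u\<in>T. x u * of_real (k u s)) * of_real (k t s)) + of_real (q t) * x t
        = \<mu> * of_real (r t) * x t"
    and r: "\<And>t. t \<in> T \<Longrightarrow> r t > 0"
    and nontrivial: "\<exists>t\<in>T. x t \<noteq> 0"
  shows "\<mu> \<in> \<real>"
proof -
  \<comment> \<open>\<open>y\<close> is the transposed matrix applied to \<open>x\<close>: here
    \<open>k\<close> is summed over its first index, in the outer sum of \<open>eq\<close> over its
    second.\<close>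
  define y where "y s = (\<Sum>u\<in>T. x u * of_real (k u s))" for s
  have "(\<Sum>t\<in>T. cnj (x t) * (\<Sum>s\<in>T. of_real (p s) * y s * of_real (k t s)))
      = (\<Sum>t\<in>T. \<Sum>s\<in>T. of_real (p s) * y s * (cnj (x t) * of_real (k t s)))"
    by (simp add: sum_distrib_left mult_ac)
  also have "\<dots> = (\<Sum>s\<in>T. of_real (p s) * y s * (\<Sum>t\<in>T. cnj (x t) * of_real (k t s)))"
    by (subst sum.swap) (simp add: sum_distrib_left)
  \<comment> \<open>As \<open>k\<close> is real, the inner sum over \<open>t\<close> is the
    conjugate of \<open>y s\<close>.\<close>
  also have "\<dots> = (\<Sum>s\<in>T. of_real (p s) * (y s * cnj (y s)))"
    by (simp add: y_def mult_ac)
  also have "\<dots> = of_real (\<Sum>s\<in>T. p s * (norm (y s))\<^sup>2)"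
    by (simp del: of_real_power add: complex_norm_square)
  finally have gram: "(\<Sum>t\<in>T. cnj (x t) * (\<Sum>s\<in>T. of_real (p s) * y s * of_real (k t s)))
      = of_real (\<Sum>s\<in>T. p s * (norm (y s))\<^sup>2)" .
  have "(\<Sum>t\<in>T. cnj (x t) * (\<Sum>s\<in>T. of_real (p s) * y s * of_real (k t s)))
        + of_real (\<Sum>t\<in>T. q t * (norm (x t))\<^sup>2)
      = (\<Sum>t\<in>T. cnj (x t) *
          ((\<Sum>s\<in>T. of_real (p s) * y s * of_real (k t s)) + of_real (q t) * x t))"
    by (simp del: of_real_power add: complex_norm_square distrib_left sum.distrib mult_ac)
  also have "\<dots> = (\<Sum>t\<in>T. cnj (x t) * (\<mu> * of_real (r t) * x t))"
    using eq by (simp add: y_def)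
  also have "\<dots> = \<mu> * of_real (\<Sum>t\<in>T. r t * (norm (x t))\<^sup>2)"
    by (simp del: of_real_power add: complex_norm_square sum_distrib_left mult_ac)
  finally have pairing: "of_real ((\<Sum>s\<in>T. p s * (norm (y s))\<^sup>2) + (\<Sum>t\<in>T. q t * (norm (x t))\<^sup>2))
      = \<mu> * of_real (\<Sum>t\<in>T. r t * (norm (x t))\<^sup>2)"
    by (simp add: gram)
  obtain t where t: "t \<in> T" "x t \<noteq> 0"
    using nontrivial by blast
  have "(\<Sum>t\<in>T. r t * (norm (x t))\<^sup>2) > 0"
    by (rule sum_pos2[OF fin t(1)]) (use t r in \<open>auto simp: less_imp_le\<close>)
  then have "\<mu> = of_real (((\<Sum>s\<in>T. p s * (norm (y s))\<^sup>2) + (\<Sum>t\<in>T. q t * (norm (x t))\<^sup>2))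
      / (\<Sum>t\<in>T. r t * (norm (x t))\<^sup>2))"
    unfolding of_real_divide pairing by (simp del: of_real_sum)
  then show ?thesis
    by (rule ssubst) (rule Reals_of_real)
qed

lemma finite_time_scale: "finite (time_scale c d)"
proof (rule finite_subset)
  show "time_scale c d \<subseteq> (\<lambda>k. c + real k) ` {..nat \<lfloor>d - c\<rfloor>}"
  proof
    fix s assume "s \<in> time_scale c d"
    then obtain k where k: "s = c + real k" "s \<le> d"
      by (auto simp: time_scale_def)
    then have "k \<le> nat \<lfloor>d - c\<rfloor>"
      by (intro le_nat_floor) simp
    with k(1) show "s \<in> (\<lambda>k. c + real k) ` {..nat \<lfloor>d - c\<rfloor>}"
      by blast
  qed
qed simp

lemma time_scale_initial_segment:
  assumes "u \<le> d"
  shows "time_scale c u = {s \<in> time_scale c d. s \<le> u}"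
  using assms by (auto simp: time_scale_def)

text \<open>The grid of \<open>time_scale u d\<close> starts at \<open>u\<close>, so
  \<open>u\<close> must lie on the grid of \<open>c\<close>. It may exceed \<open>d\<close>, where
  both sides are empty; this covers the sum from \<open>t + 1\<close> at the last point.\<close>

lemma time_scale_final_segment:
  assumes "u = c + real k"
  shows "time_scale u d = {s \<in> time_scale c d. u \<le> s}"
proof (intro equalityI subsetI)
  fix s assume "s \<in> time_scale u d"
  then obtain j where "s = u + real j" "s \<le> d"
    by (auto simp: time_scale_def)
  then have "s = c + real (k + j)" "s \<le> d" "u \<le> s"
    using assms by auto
  then show "s \<in> {s \<in> time_scale c d. u \<le> s}"
    unfolding time_scale_def by blast
next
  fix s assume "s \<in> {s \<in> time_scale c d. u \<le> s}"
  then obtain j where j: "s = c + real j" "s \<le> d" "u \<le> s"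
    by (auto simp: time_scale_def)
  \<comment> \<open>\<open>u \<le> s\<close> forces \<open>k \<le> j\<close>, so the subtraction of
    naturals does not truncate.\<close>
  then have "s = u + real (j - k)"
    using assms by (simp add: of_nat_diff)
  then show "s \<in> time_scale u d"
    using j(2) unfolding time_scale_def by blast
qed

text \<open>The \<open>(t, s)\<close> entry of the matrix of the left difference.\<close>

definition ABR_kernel :: "(real \<Rightarrow> real) \<Rightarrow> real \<Rightarrow> real \<Rightarrow> real \<Rightarrow> real" where
  "ABR_kernel B \<alpha> t s = B \<alpha> / (1 - \<alpha>) *
     ((if s \<le> t then nabla_ML \<alpha> (- \<alpha> / (1 - \<alpha>)) (t - s + 1) else 0)
       - (if s \<le> t - 1 then nabla_ML \<alpha> (- \<alpha> / (1 - \<alpha>)) (t - s) else 0))"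

text \<open>Extending the kernel by zero gives sums over different segments a common index set, so
  that they can be subtracted termwise.\<close>

lemma sum_filter_of_real_mult:
  fixes f :: "'a \<Rightarrow> complex"
  assumes "finite T"
  shows "(\<Sum>s\<in>{s \<in> T. P s}. f s * of_real (g s)) = (\<Sum>s\<in>T. f s * of_real (if P s then g s else 0))"
  using assms by (auto simp: sum.inter_filter intro!: sum.cong)

text \<open>The kernel vanishes for \<open>s > t\<close>, so the sum may run up to any
  \<open>d\<close> beyond \<open>t\<close>. One fixed \<open>d\<close> for all \<open>t\<close>
  makes the matrix square.\<close>

lemma ABR_left_eq_kernel_sum:
  assumes "t \<le> d"
  shows "ABR_left B \<alpha> a f t = (\<Sum>s\<in>time_scale (a + 1) d. f s * of_real (ABR_kernel B \<alpha> t s))"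
proof -
  have "time_scale (a + 1) t = {s \<in> time_scale (a + 1) d. s \<le> t}"
    "time_scale (a + 1) (t - 1) = {s \<in> time_scale (a + 1) d. s \<le> t - 1}"
    using assms by (auto intro!: time_scale_initial_segment)
  moreover have args: "t - rho s = t - s + 1" "t - 1 - rho s = t - s" for s
    by (simp_all add: rho_def)
  ultimately show ?thesis
    unfolding ABR_left_def nabla_def
    by (simp only: sum_filter_of_real_mult finite_time_scale sum_distrib_left args ABR_kernel_def
          flip: sum_subtractf)
      (rule sum.cong; simp add: right_diff_distrib mult_ac)
qed

text \<open>This is the integration by parts: the kernel has its arguments exchanged. The minus sign
  in \<open>ABR_right\<close> turns the forward difference into the sum from \<open>t\<close> minus
  the sum from \<open>t + 1\<close>, which is the shape of the kernel.\<close>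

lemma ABR_right_eq_kernel_sum:
  assumes "t \<in> time_scale c d"
  shows "ABR_right B \<alpha> (d + 1) f t = (\<Sum>s\<in>time_scale c d. f s * of_real (ABR_kernel B \<alpha> s t))"
proof -
  obtain k where k: "t = c + real k"
    using assms by (auto simp: time_scale_def)
  have "time_scale t d = {s \<in> time_scale c d. t \<le> s}"
    by (rule time_scale_final_segment[OF k])
  moreover have "time_scale (t + 1) d = {s \<in> time_scale c d. t + 1 \<le> s}"
    by (rule time_scale_final_segment[of _ _ "Suc k"]) (simp add: k)
  moreover have args: "s - rho t = s - t + 1" "s - rho (t + 1) = s - t"
    "t + 1 \<le> s \<longleftrightarrow> t \<le> s - 1" for s
    by (auto simp: rho_def)
  ultimately show ?thesis
    unfolding ABR_right_def delta_def add_diff_cancel_right'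
    by (simp only: sum_filter_of_real_mult finite_time_scale sum_distrib_left args ABR_kernel_def
          flip: sum_subtractf)
      (rule sum.cong; simp add: right_diff_distrib mult_ac)
qed

theorem theorem9:
  fixes a b \<alpha> :: real
    and B p q r :: "real \<Rightarrow> real"
    and \<mu> :: complex
  assumes "\<exists>n::nat. n > 0 \<and> b - a = real n"
    and "0 < \<alpha>" and "\<alpha> < 1 / 2"
    and "B \<alpha> > 0"
    and "\<forall>t\<in>time_scale a b. p t > 0"
    and "\<forall>t\<in>time_scale a b. r t > 0"
    and "SL_eigenvalue B \<alpha> a b p q r \<mu>"
  shows "\<mu> \<in> \<real>"
proof -
  define T where "T = time_scale (a + 1) (b - 1)"
  obtain x where sol: "SL_solution B \<alpha> a b p q r \<mu> x" and nontrivial: "\<exists>t\<in>T. x t \<noteq> 0"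
    using assms(7) by (auto simp: SL_eigenvalue_def SL_eigenfunction_def T_def)
  have right: "ABR_right B \<alpha> b x s = (\<Sum>u\<in>T. x u * of_real (ABR_kernel B \<alpha> u s))"
    if "s \<in> T" for s
    using ABR_right_eq_kernel_sum[of s "a + 1" "b - 1"] that by (simp add: T_def)
  have left: "ABR_left B \<alpha> a f t = (\<Sum>s\<in>T. f s * of_real (ABR_kernel B \<alpha> t s))"
    if "t \<in> T" for f t
    unfolding T_def
    by (rule ABR_left_eq_kernel_sum) (use that in \<open>auto simp: T_def time_scale_def\<close>)
  \<comment> \<open>\<open>time_scale a b\<close> is cut at \<open>a + 1\<close> from below, then at
    \<open>b - 1\<close> from above.\<close>
  have "T \<subseteq> time_scale a b"
    using time_scale_final_segment[of "a + 1" a 1 b]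
      time_scale_initial_segment[of "b - 1" b "a + 1"] by (auto simp: T_def)
  with assms(6) have "r t > 0" if "t \<in> T" for t
    using that by blast
  then show ?thesis
  proof (rule weighted_gram_eigenvalue_real[rotated 2])
    show "finite T"
      by (simp add: T_def finite_time_scale)
    fix t assume t: "t \<in> T"
    \<comment> \<open>With \<open>K\<close> from \<open>left\<close> and its transpose from
      \<open>right\<close>, the operator is \<open>K diag(p) K\<^sup>T + diag(q)\<close>.\<close>
    show "(\<Sum>s\<in>T. of_real (p s) * (\<Sum>u\<in>T. x u * of_real (ABR_kernel B \<alpha> u s))
          * of_real (ABR_kernel B \<alpha> t s)) + of_real (q t) * x t = \<mu> * of_real (r t) * x t"
      using sol t by (simp add: SL_solution_def left right flip: T_def)
  qed (use nontrivial in auto)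
qed

end
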